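(* Let $k \geq 2$ be a natural number and let $G$ be a finite bipartite graph of average degree at least $4k$ and girth $g$. Then there exist cycles of $(g/2 - 1)k$ consecutive even lengths in $G$, i.e. there is an even integer $\ell$ such that $G$ contains a cycle of length $\ell + 2i$ for every $i = 0, 1, \ldots, (g/2-1)k - 1$. Moreover, the shortest of these cycles (of length $\ell$) has length at most twice the radius of $G$.
   Context: The average degree of a graph $G$ is $2|E(G)|/|V(G)|$. The girth of $G$ is the length of a shortest cycle in $G$. The radius of a connected graph is $\min_{v}\max_{u} d(u,v)$, where $d$ is the graph distance. *)

theory Defs
  imports Complex_Main "HOL-Library.Extended_Nat"
begin

text \<open>A graph is given by its vertex set \<open>V\<close> and its edge set \<open>E\<close>, whose members are two-element
  subsets of \<open>V\<close>.\<close>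

definition finite_simple_graph :: "'a set \<Rightarrow> 'a set set \<Rightarrow> bool" where
  "finite_simple_graph V E \<longleftrightarrow> finite V \<and> (\<forall>e\<in>E. \<exists>u\<in>V. \<exists>v\<in>V. u \<noteq> v \<and> e = {u, v})"

definition bipartite_graph :: "'a set \<Rightarrow> 'a set set \<Rightarrow> bool" where
  "bipartite_graph V E \<longleftrightarrow>
     (\<exists>A B. A \<union> B = V \<and> A \<inter> B = {} \<and> (\<forall>e\<in>E. \<exists>a\<in>A. \<exists>b\<in>B. e = {a, b}))"

definition average_degree :: "'a set \<Rightarrow> 'a set set \<Rightarrow> real" where
  "average_degree V E = 2 * real (card E) / real (card V)"

text \<open>A cycle is represented by the list of its vertices in cyclic order, without repeating the
  first vertex at the end; its number of edges is the length of the list.\<close>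

definition is_cycle :: "'a set set \<Rightarrow> 'a list \<Rightarrow> bool" where
  "is_cycle E c \<longleftrightarrow> length c \<ge> 3 \<and> distinct c \<and>
     successively (\<lambda>x y. {x, y} \<in> E) c \<and> {last c, hd c} \<in> E"

definition has_cycle_of_length :: "'a set set \<Rightarrow> nat \<Rightarrow> bool" where
  "has_cycle_of_length E n \<longleftrightarrow> (\<exists>c. is_cycle E c \<and> length c = n)"

text \<open>The girth of a graph without cycles is \<open>\<infinity>\<close>.\<close>

definition girth :: "'a set set \<Rightarrow> enat" where
  "girth E = (INF c \<in> {c. is_cycle E c}. enat (length c))"

definition is_walk :: "'a set \<Rightarrow> 'a set set \<Rightarrow> 'a \<Rightarrow> 'a list \<Rightarrow> 'a \<Rightarrow> bool" where
  "is_walk V E u p v \<longleftrightarrow> p \<noteq> [] \<and> set p \<subseteq> V \<and> hd p = u \<and> last p = v \<and>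
     successively (\<lambda>x y. {x, y} \<in> E) p"

definition connected_graph :: "'a set \<Rightarrow> 'a set set \<Rightarrow> bool" where
  "connected_graph V E \<longleftrightarrow> V \<noteq> {} \<and> (\<forall>u\<in>V. \<forall>v\<in>V. \<exists>p. is_walk V E u p v)"

text \<open>A walk is listed by its vertices, so its number of edges is the length of the list minus one.\<close>

definition graph_dist :: "'a set \<Rightarrow> 'a set set \<Rightarrow> 'a \<Rightarrow> 'a \<Rightarrow> enat" where
  "graph_dist V E u v = (INF p \<in> {p. is_walk V E u p v}. enat (length p - 1))"

definition radius :: "'a set \<Rightarrow> 'a set set \<Rightarrow> enat" where
  "radius V E = (INF v \<in> V. SUP u \<in> V. graph_dist V E u v)"

end

theory Submission
  imports Defs
begin

text \<open>In a breadth-first search from a central vertex, two consecutive levels of a dense component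
  span a subgraph with more than \<open>k\<close> times as many edges as vertices. A longest path in a subgraph
  of it with minimum degree above \<open>k\<close> closes up to a cycle with a chord on at least \<open>k (g - 2) + 2\<close>
  vertices. Split its vertices on the upper level into two nonempty classes by the subtree they lie
  in below their lowest common ancestor. The cycle with its chord contains paths of every even
  length less than its order between the two classes, and all these paths are closed up through
  the search tree by paths of one fixed length.\<close>

section \<open>Periodic functions on the integers\<close>

lemma periodic_mult:
  fixes c :: "int \<Rightarrow> 'b" and d m :: int
  assumes "\<And>x. c (x + d) = c x"
  shows "c (x + m * d) = c x"
proof (induction m rule: int_induct[where k = 0])
  case (step1 i)
  then show ?case using assms[of "x + i * d"] by (simp add: algebra_simps)
next
  case (step2 i)
  then show ?case using assms[of "x + (i - 1) * d"] by (simp add: algebra_simps)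
qed simp

lemma periodic_diff:
  fixes c :: "int \<Rightarrow> 'b" and d :: int
  assumes "\<And>x. c (x + d) = c x"
  shows "c (x - d) = c x"
  using assms[of "x - d"] by simp

lemma periodic_gcd:
  fixes c :: "int \<Rightarrow> 'b" and m n :: int
  assumes m: "\<And>x. c (x + m) = c x" and n: "\<And>x. c (x + n) = c x"
  shows "c (x + gcd m n) = c x"
proof -
  obtain u v where "u * m + v * n = gcd m n"
    using bezout_int by blast
  then have "c (x + gcd m n) = c (x + u * m + v * n)"
    by (simp add: add.assoc)
  then show ?thesis
    by (simp add: periodic_mult[of c, OF m] periodic_mult[of c, OF n])
qed

text \<open>The path hypotheses below give equalities only on bounded ranges of positions. One full
  period is enough, since every integer is congruent modulo \<open>d\<close> to a point of the
  window starting at \<open>u\<close>.\<close>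

lemma periodic_eqI:
  fixes h h' :: "int \<Rightarrow> 'b" and d u :: int
  assumes "d > 0" and h: "\<And>x. h (x + d) = h x" and h': "\<And>x. h' (x + d) = h' x"
    and eq: "\<And>x. u \<le> x \<Longrightarrow> x < u + d \<Longrightarrow> h x = h' x"
  shows "h x = h' x"
proof -
  define y where "y = u + (x - u) mod d"
  have x: "x = y + ((x - u) div d) * d"
    unfolding y_def using div_mult_mod_eq[of "x - u" d] by linarith
  have "h y = h' y"
    using \<open>d > 0\<close> by (intro eq) (auto simp: y_def)
  then show ?thesis
    using periodic_mult[of h d y "(x - u) div d", OF h] periodic_mult[of h' d y "(x - u) div d", OF h'] x
    by metis
qed

text \<open>In the next two lemmas \<open>c\<close> colours the vertices of an \<open>n\<close>-cycle with the chord \<open>{0, r}\<close>, and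
  the hypotheses \<open>I\<close>, \<open>I'\<close>, \<open>II\<close>, \<open>III\<close> say that the four kinds of paths of length \<open>t\<close> through the
  chord have ends of the same colour.\<close>

lemma chord_period_two_half:
  fixes c :: "int \<Rightarrow> 'b" and n r t :: int
  assumes r: "2 \<le> r" and t: "r < t" "t \<le> n - r" "t < n"
    and per_t: "\<And>x. c (x + t) = c x"
    and I: "\<And>a. 0 \<le> a \<Longrightarrow> a \<le> t - 1 \<Longrightarrow> c (- a) = c (r + t - 1 - a)"
    and II: "\<And>a. 0 \<le> a \<Longrightarrow> a \<le> r - 1 \<Longrightarrow> 0 \<le> t - 1 - a \<Longrightarrow> t - 1 - a \<le> n - r - 1
        \<Longrightarrow> c a = c (r + t - 1 - a)"
    and III: "\<And>a. 0 \<le> a \<Longrightarrow> a \<le> n - r - 1 \<Longrightarrow> 0 \<le> t - 1 - a \<Longrightarrow> t - 1 - a \<le> r - 1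
        \<Longrightarrow> c (- a) = c (r - (t - 1 - a))"
  shows "c (x + 2) = c x"
proof -
  have per_t': "c (x - t) = c x" for x
    by (rule periodic_diff[of c, OF per_t])
  \<comment> \<open>Up to the period \<open>t\<close>, \<open>I\<close> at \<open>a = - x\<close> is
    the shift by \<open>r - 1\<close>; the range of \<open>a\<close> is exactly one period.\<close>
  have shift: "c (x + (r - 1)) = c x" for x
  proof (rule periodic_eqI[where d = t and u = "1 - t" and h = "\<lambda>x. c (x + (r - 1))"])
    fix x assume "1 - t \<le> x" "x < 1 - t + t"
    then have "c x = c (r + t - 1 + x)" using I[of "- x"] by simp
    then show "c (x + (r - 1)) = c x" using per_t[of "x + (r - 1)"] by (simp add: algebra_simps)
  qed (use r t per_t[of "_ + (r - 1)"] per_t in \<open>auto simp: algebra_simps\<close>)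
  have shift': "c (x - (r - 1)) = c x" for x
    by (rule periodic_diff[of c, OF shift])
  \<comment> \<open>Up to the periods \<open>t\<close> and \<open>r - 1\<close>, \<open>II\<close>
    becomes this reflection and \<open>III\<close> becomes the reflection taking \<open>- x\<close>
    to \<open>2 + x\<close>. Together they give the translation by 2.\<close>
  have refl: "c x = c (- x)" for x
  proof (rule periodic_eqI[where d = "r - 1" and u = 0 and h = c])
    fix x assume x: "0 \<le> x" "x < 0 + (r - 1)"
    then have "c x = c (r + t - 1 - x)" using t by (intro II) auto
    then show "c x = c (- x)"
      using per_t[of "- x + (r - 1)"] shift[of "- x"] by (simp add: algebra_simps)
  qed (use r shift shift'[of "- _"] in \<open>auto simp: algebra_simps\<close>)
  have "c (- x) = c (2 + x)" for x
  proof (rule periodic_eqI[where d = "r - 1" and u = "t - r" and h = "\<lambda>x. c (- x)"])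
    fix x assume x: "t - r \<le> x" "x < t - r + (r - 1)"
    then have "c (- x) = c (r - (t - 1 - x))" using t by (intro III) auto
    then show "c (- x) = c (2 + x)"
      using per_t'[of "2 + x + (r - 1)"] shift[of "2 + x"] by (simp add: algebra_simps)
  qed (use r shift[of "2 + _"] shift'[of "- _"] in \<open>auto simp: algebra_simps\<close>)
  then show ?thesis using refl[of x] by (simp add: add.commute)
qed

lemma chord_period_two:
  fixes c :: "int \<Rightarrow> 'b" and n r t :: int
  assumes r: "2 \<le> r" "r \<le> n - 2" and t: "0 < t" "t < n"
    and per_n: "\<And>x. c (x + n) = c x" and per_t: "\<And>x. c (x + t) = c x"
    and I: "\<And>a. t \<le> n - r \<Longrightarrow> 0 \<le> a \<Longrightarrow> a \<le> t - 1 \<Longrightarrow> c (- a) = c (r + t - 1 - a)"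
    and I': "\<And>a. t \<le> r \<Longrightarrow> 0 \<le> a \<Longrightarrow> a \<le> t - 1 \<Longrightarrow> c (r - a) = c (t - 1 - a)"
    and II: "\<And>a. 0 \<le> a \<Longrightarrow> a \<le> r - 1 \<Longrightarrow> 0 \<le> t - 1 - a \<Longrightarrow> t - 1 - a \<le> n - r - 1
        \<Longrightarrow> c a = c (r + t - 1 - a)"
    and III: "\<And>a. 0 \<le> a \<Longrightarrow> a \<le> n - r - 1 \<Longrightarrow> 0 \<le> t - 1 - a \<Longrightarrow> t - 1 - a \<le> r - 1
        \<Longrightarrow> c (- a) = c (r - (t - 1 - a))"
  shows "c (x + 2) = c x"
proof -
  have per_n': "c (x - n) = c x" and per_t': "c (x - t) = c x" for x
    using periodic_diff[of c, OF per_n] periodic_diff[of c, OF per_t] by auto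
  consider "t \<le> r" "t \<le> n - r" | "r < t" "t \<le> n - r" | "t \<le> r" "n - r < t" | "r < t" "n - r < t"
    by linarith
  then show ?thesis
  proof cases
    \<comment> \<open>\<open>I\<close> gives the period \<open>r - 1\<close> and \<open>I'\<close>
      the period \<open>r + 1\<close>; the difference is 2.\<close>
    case 1
    have A: "c (x + (r - 1)) = c x" for x
    proof (rule periodic_eqI[where d = t and u = "1 - t" and h = "\<lambda>x. c (x + (r - 1))"])
      fix x assume "1 - t \<le> x" "x < 1 - t + t"
      then have "c x = c (r + t - 1 + x)" using I[of "- x"] 1 by simp
      then show "c (x + (r - 1)) = c x"
        using per_t[of "x + (r - 1)"] by (simp add: algebra_simps)
    qed (use t per_t[of "_ + (r - 1)"] per_t in \<open>auto simp: algebra_simps\<close>)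
    have B: "c (x + (r + 1)) = c x" for x
    proof (rule periodic_eqI[where d = t and u = "- t" and h = "\<lambda>x. c (x + (r + 1))"])
      fix x assume "- t \<le> x" "x < - t + t"
      then have "c (r + (x + 1)) = c (t + x)"
        using I'[of "- 1 - x"] 1 by (simp add: algebra_simps)
      then show "c (x + (r + 1)) = c x"
        using per_t[of x] by (simp add: algebra_simps)
    qed (use t per_t[of "_ + (r + 1)"] per_t in \<open>auto simp: algebra_simps\<close>)
    show ?thesis using A[of "x + 2"] B[of x] by (simp add: algebra_simps)
  next
    case 2
    then show ?thesis
      using r t per_t I II III by (intro chord_period_two_half[of r t n c]) auto
  next
    \<comment> \<open>Reading the cycle backwards turns the chord into one from 0 to
      \<open>n - r\<close>. Then \<open>I'\<close> takes the role of \<open>I\<close>, and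
      \<open>II\<close> and \<open>III\<close> change places.\<close>
    case 3
    have "c (- (y + 2)) = c (- y)" for y
    proof (rule chord_period_two_half[of "n - r" t n "\<lambda>x. c (- x)"])
      show "c (- (x + t)) = c (- x)" for x using per_t'[of "- x"] by simp
      show "c (- (- a)) = c (- (n - r + t - 1 - a))" if "0 \<le> a" "a \<le> t - 1" for a
        using I'[of "t - 1 - a"] 3 that per_n'[of "r - (t - 1 - a)"] by (simp add: algebra_simps)
      show "c (- a) = c (- (n - r + t - 1 - a))"
        if "0 \<le> a" "a \<le> n - r - 1" "0 \<le> t - 1 - a" "t - 1 - a \<le> n - (n - r) - 1" for a
        using III[of a] that per_n'[of "r - (t - 1 - a)"] by (simp add: algebra_simps)
      show "c (- (- a)) = c (- (n - r - (t - 1 - a)))"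
        if "0 \<le> a" "a \<le> n - (n - r) - 1" "0 \<le> t - 1 - a" "t - 1 - a \<le> n - r - 1" for a
        using II[of a] that per_n'[of "r + t - 1 - a"] by (simp add: algebra_simps)
    qed (use r t 3 in auto)
    from this[of "- x - 2"] show ?thesis by (simp add: algebra_simps)
  next
    \<comment> \<open>Neither \<open>I\<close> nor \<open>I'\<close> applies, as \<open>t\<close>
      exceeds both sides. \<open>II\<close> and \<open>III\<close> each hold on \<open>n - t\<close>
      consecutive positions, which cover a whole period \<open>gcd n t\<close> because this divides
      \<open>n - t\<close>. Again two reflections compose to the translation by 2.\<close>
    case 4
    define d where "d = gcd n t"
    have d: "d > 0" and "d dvd n - t" using t by (auto simp: d_def)
    then have "d \<le> n - t" using t by (intro zdvd_imp_le) auto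
    have per_d: "c (x + d) = c x" for x
      unfolding d_def by (rule periodic_gcd[of c, OF per_n per_t])
    have per_d': "c (x - d) = c x" for x
      by (rule periodic_diff[of c, OF per_d])
    have A: "c x = c (r - 1 - x)" for x
    proof (rule periodic_eqI[where d = d and u = "t - n + r" and h = c])
      fix x assume x: "t - n + r \<le> x" "x < t - n + r + d"
      then have "c x = c (r + t - 1 - x)" using 4 \<open>d \<le> n - t\<close> by (intro II) auto
      then show "c x = c (r - 1 - x)"
        using per_t[of "r - 1 - x"] by (simp add: algebra_simps)
    qed (use d per_d per_d'[of "r - 1 - _"] in \<open>auto simp: algebra_simps\<close>)
    have B: "c (- x) = c (r + 1 + x)" for x
    proof (rule periodic_eqI[where d = d and u = "t - r" and h = "\<lambda>x. c (- x)"])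
      fix x assume x: "t - r \<le> x" "x < t - r + d"
      then have "c (- x) = c (r - (t - 1 - x))" using 4 \<open>d \<le> n - t\<close> by (intro III) auto
      then show "c (- x) = c (r + 1 + x)"
        using per_t'[of "r + 1 + x"] by (simp add: algebra_simps)
    qed (use d per_d[of "r + 1 + _"] per_d'[of "- _"] in \<open>auto simp: algebra_simps\<close>)
    show ?thesis using A[of "- x - 2 + r + 1"] B[of "- x - 2 + r + 1 - r - 1"] A B
      by (smt (verit))
  qed
qed

section \<open>Paths in a cycle with a chord\<close>

definition simple_path :: "'a set set \<Rightarrow> 'a list \<Rightarrow> bool" where
  "simple_path E p \<longleftrightarrow> p \<noteq> [] \<and> distinct p \<and> successively (\<lambda>x y. {x, y} \<in> E) p"

lemma simple_path_append:
  assumes "simple_path E p" "simple_path E q" "{last p, hd q} \<in> E" "set p \<inter> set q = {}"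
  shows "simple_path E (p @ q)"
  using assms by (auto simp: simple_path_def successively_append_iff)

lemma simple_path_rev:
  "simple_path E (rev p) \<longleftrightarrow> simple_path E p"
  by (simp add: simple_path_def insert_commute)

text \<open>Indexing the vertices by all integers modulo \<open>n\<close> makes every arc the image
  of an interval, wherever the cycle wraps around. The bounds on \<open>r\<close> say that the ends
  of the chord are not neighbours on the cycle.\<close>

locale chorded_cycle =
  fixes E :: "'a set set" and f :: "int \<Rightarrow> 'a" and n r :: int
  assumes f_eq: "f x = f y \<longleftrightarrow> x mod n = y mod n"
    and edge: "{f x, f (x + 1)} \<in> E"
    and chord: "{f 0, f r} \<in> E"
    and r: "2 \<le> r" "r \<le> n - 2"
begin

lemma f_neq:
  assumes "x < y" "y < x + n"
  shows "f x \<noteq> f y"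
proof
  assume "f x = f y"
  then have "n dvd y - x" by (metis f_eq mod_eq_dvd_iff)
  then show False using assms zdvd_imp_le[of n "y - x"] by auto
qed

lemma simple_path_arc:
  assumes "u \<le> v" "v < u + n"
  shows "simple_path E (map f [u..v])"
proof -
  have "inj_on f {u..v}"
  proof (rule inj_onI)
    fix x y assume "x \<in> {u..v}" "y \<in> {u..v}" "f x = f y"
    then show "x = y" using f_neq[of x y] f_neq[of y x] assms by (cases x y rule: linorder_cases) auto
  qed
  moreover have "successively (\<lambda>x y. {f x, f y} \<in> E) [u..v]"
    using edge[of "u + int _"] by (auto simp: successively_conv_nth algebra_simps)
  ultimately show ?thesis
    using assms by (auto simp: simple_path_def distinct_map successively_map)
qed

lemma hd_last_arc:
  assumes "u \<le> v"
  shows "hd (map f [u..v]) = f u" "last (map f [u..v]) = f v"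
proof -
  have "hd [u..v] = u" using assms by (simp add: upto.simps)
  moreover have "last [u..v] = v" using assms by (simp add: upto_rec2)
  ultimately show "hd (map f [u..v]) = f u" "last (map f [u..v]) = f v"
    using assms by (simp_all add: hd_map last_map)
qed

lemma disjoint_arcs:
  assumes "v < u'" "v' < u + n"
  shows "set (map f [u..v]) \<inter> set (map f [u'..v']) = {}"
proof -
  have "f x \<noteq> f y" if "x \<in> {u..v}" "y \<in> {u'..v'}" for x y
    using that assms by (intro f_neq) auto
  then show ?thesis by fastforce
qed

text \<open>Otherwise colour position \<open>x\<close> by membership of \<open>f x\<close> in
  \<open>A\<close>. All paths with \<open>t\<close> edges, along the cycle or across the chord, then
  have ends of one colour, so \<open>chord_period_two\<close> makes the colouring 2-periodic,
  against the choice of \<open>z\<close>.\<close>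

lemma ex_path_leaving:
  fixes t :: nat
  assumes t: "0 < t" "int t < n" and A: "f (z + 2) \<in> A \<longleftrightarrow> f z \<notin> A"
  shows "\<exists>p. simple_path E p \<and> set p \<subseteq> range f \<and> length p = t + 1 \<and> hd p \<in> A \<and> last p \<notin> A"
proof (rule ccontr)
  assume none: "\<nexists>p. simple_path E p \<and> set p \<subseteq> range f \<and> length p = t + 1 \<and> hd p \<in> A \<and> last p \<notin> A"
  \<comment> \<open>\<open>none\<close> excludes paths out of \<open>A\<close>; reversing a path
    excludes paths into \<open>A\<close>.\<close>
  have same: "hd p \<in> A \<longleftrightarrow> last p \<in> A"
    if p: "simple_path E p" "set p \<subseteq> range f" "length p = t + 1" for p
  proof -
    have "p \<noteq> []" using p by auto
    then show ?thesis
      using none p simple_path_rev[of E p]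
      by (metis hd_rev last_rev length_rev set_rev)
  qed
  have join: "hd p \<in> A \<longleftrightarrow> last q \<in> A"
    if "simple_path E p" "simple_path E q" "{last p, hd q} \<in> E" "set p \<inter> set q = {}"
      "set p \<subseteq> range f" "set q \<subseteq> range f" "int (length p) + int (length q) = int t + 1" for p q
    using same[of "p @ q"] simple_path_append[of E p q] that by (auto simp: simple_path_def)
  note arcs = simple_path_rev simple_path_arc hd_last_arc hd_rev last_rev
  have "f (x + 2) \<in> A \<longleftrightarrow> f x \<in> A" for x
  proof (rule chord_period_two[of r n "int t" "\<lambda>x. f x \<in> A"])
    show "(f (x + n) \<in> A) = (f x \<in> A)" for x
      using f_eq[of "x + n" x] by simp
    show "(f (x + int t) \<in> A) = (f x \<in> A)" for x
      using same[of "map f [x..x + int t]"] t simple_path_arc[of x "x + int t"] hd_last_arc[of x "x + int t"]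
      by (auto simp: nat_add_distrib image_subset_iff)
    \<comment> \<open>In this and the next three goals the chord joins an arc of
      \<open>a + 1\<close> vertices to one of \<open>t - a\<close> vertices. The arcs lie on the
      same side of the chord in the first two goals and on different sides in the last two.\<close>
    show "(f (- a) \<in> A) = (f (r + int t - 1 - a) \<in> A)"
      if "int t \<le> n - r" "0 \<le> a" "a \<le> int t - 1" for a
      using join[of "map f [- a..0]" "map f [r..r + int t - 1 - a]"] that r t chord
        disjoint_arcs[of 0 r "r + int t - 1 - a" "- a"]
      by (auto simp: arcs image_subset_iff)
    show "(f (r - a) \<in> A) = (f (int t - 1 - a) \<in> A)"
      if "int t \<le> r" "0 \<le> a" "a \<le> int t - 1" for a
      using join[of "map f [r - a..r]" "map f [0..int t - 1 - a]"] that r t chord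
        disjoint_arcs[of "int t - 1 - a" "r - a" r 0]
      by (auto simp: arcs image_subset_iff insert_commute Int_commute)
    show "(f a \<in> A) = (f (r + int t - 1 - a) \<in> A)"
      if "0 \<le> a" "a \<le> r - 1" "0 \<le> int t - 1 - a" "int t - 1 - a \<le> n - r - 1" for a
      using join[of "rev (map f [0..a])" "map f [r..r + int t - 1 - a]"] that r t chord
        disjoint_arcs[of a r "r + int t - 1 - a" 0]
      by (auto simp: arcs image_subset_iff)
    show "(f (- a) \<in> A) = (f (r - (int t - 1 - a)) \<in> A)"
      if "0 \<le> a" "a \<le> n - r - 1" "0 \<le> int t - 1 - a" "int t - 1 - a \<le> r - 1" for a
      using join[of "map f [- a..0]" "rev (map f [r - (int t - 1 - a)..r])"] that r t chord
        disjoint_arcs[of 0 "r - (int t - 1 - a)" r "- a"]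
      by (auto simp: arcs image_subset_iff)
  qed (use r t in auto)
  then show False using A by blast
qed

end

section \<open>A long cycle with a chord from a minimum degree condition\<close>

text \<open>Turns a lower bound on the gaps between neighbours along a path into a lower bound on
  its length. Removing the maximum costs one gap.\<close>

lemma gaps_imp_spread:
  fixes N :: "nat set"
  assumes "finite N" "card N = Suc q" "\<And>i j. i \<in> N \<Longrightarrow> j \<in> N \<Longrightarrow> i < j \<Longrightarrow> i + m \<le> j"
  shows "\<exists>i\<in>N. \<exists>j\<in>N. i + q * m \<le> j"
  using assms
proof (induction q arbitrary: N)
  case 0
  then show ?case by (auto simp: card_Suc_eq)
next
  case (Suc q)
  define M where "M = Max N"
  have M: "M \<in> N" using Suc.prems by (auto simp: M_def intro!: Max_in)
  have "\<exists>i\<in>N - {M}. \<exists>j\<in>N - {M}. i + q * m \<le> j"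
    using Suc.prems M by (intro Suc.IH) auto
  then obtain i j where ij: "i \<in> N" "j \<in> N" "j \<noteq> M" "i + q * m \<le> j" by blast
  then have "j < M" using Suc.prems by (simp add: M_def order.not_eq_order_implies_strict)
  then have "j + m \<le> M" using Suc.prems(3) ij M by blast
  then show ?case using ij M by (intro bexI[of _ i] bexI[of _ M]) auto
qed

text \<open>All neighbours in \<open>U\<close> of the first vertex of a longest path lie on the
  path. Two of them, at positions \<open>i < j\<close>, close up to a cycle with
  \<open>j - i + 2\<close> vertices, so they are at least \<open>g - 2\<close> apart. The farthest
  neighbour closes the long cycle and a third one gives the chord.\<close>

lemma min_degree_imp_chorded_cycle:
  assumes "finite U" "U \<noteq> {}" and k: "k \<ge> 2"
    and loopless: "\<And>v. {v} \<notin> E"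
    and deg: "\<And>v. v \<in> U \<Longrightarrow> k < card {u \<in> U. {v, u} \<in> E}"
    and girth: "\<And>c. is_cycle E c \<Longrightarrow> g \<le> length c"
  shows "\<exists>f n r. chorded_cycle E f n r \<and> range f \<subseteq> U \<and> int (k * (g - 2) + 2) \<le> n"
proof -
  let ?P = "\<lambda>p. simple_path E p \<and> set p \<subseteq> U"
  obtain v where "v \<in> U" using assms by auto
  then have "?P [v]" by (auto simp: simple_path_def)
  moreover have "length p \<le> card U" if "?P p" for p
    using that \<open>finite U\<close> distinct_card[of p] card_mono[of U "set p"] by (auto simp: simple_path_def)
  ultimately obtain xs where xs: "?P xs" and max: "\<And>p. ?P p \<Longrightarrow> length p \<le> length xs"
    using ex_has_greatest_nat[of ?P "[v]" length "Suc (card U)"] le_imp_less_Suc by blast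
  have ne: "xs \<noteq> []" and dist: "distinct xs" and succ: "successively (\<lambda>x y. {x, y} \<in> E) xs"
    using xs by (auto simp: simple_path_def)
  have nth0: "hd xs = xs ! 0" using ne by (simp add: hd_conv_nth)
  have edge: "{xs ! i, xs ! Suc i} \<in> E" if "Suc i < length xs" for i
    using succ that by (auto simp: successively_conv_nth)
  define N where "N = {i. i < length xs \<and> {hd xs, xs ! i} \<in> E}"
  have N_pos: "0 < i" if "i \<in> N" for i
    using that loopless nth0 by (auto simp: N_def intro: ccontr)
  have "finite N" by (auto simp: N_def)
  have "{u \<in> U. {hd xs, u} \<in> E} \<subseteq> (!) xs ` N"
  proof
    fix u assume u: "u \<in> {u \<in> U. {hd xs, u} \<in> E}"
    have "u \<in> set xs"
    proof (rule ccontr)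
      assume "u \<notin> set xs"
      then have "?P (u # xs)"
        using u xs ne by (cases xs) (auto simp: simple_path_def insert_commute)
      then show False using max[of "u # xs"] by simp
    qed
    then show "u \<in> (!) xs ` N" using u by (auto simp: in_set_conv_nth N_def)
  qed
  then have "card {u \<in> U. {hd xs, u} \<in> E} \<le> card N"
    using surj_card_le[OF \<open>finite N\<close>] by blast
  moreover have "hd xs \<in> U" using xs ne hd_in_set by blast
  ultimately have cardN: "k < card N" using deg[of "hd xs"] by simp
  have gap: "i + (g - 2) \<le> j" if ij: "i \<in> N" "j \<in> N" "i < j" for i j
  proof -
    let ?q = "drop i (take (Suc j) xs)"
    have j: "j < length xs" and i: "0 < i" using ij N_pos by (auto simp: N_def)
    have len: "length ?q = Suc j - i" using j by simp
    have q: "hd ?q = xs ! i" "last ?q = xs ! j"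
      using j ij by (simp_all add: hd_drop_conv_nth last_conv_nth)
    have "hd xs \<notin> set ?q"
    proof
      assume "hd xs \<in> set ?q"
      then obtain m where "m < Suc j - i" "xs ! (i + m) = xs ! 0"
        using j ij nth0 by (auto simp: in_set_conv_nth)
      moreover from this have "i + m < length xs" using j by linarith
      ultimately show False using dist i ne nth_eq_iff_index_eq[of xs "i + m" 0] by simp
    qed
    moreover have "successively (\<lambda>x y. {x, y} \<in> E) ?q"
      using edge j by (auto simp: successively_conv_nth)
    ultimately have "is_cycle E (hd xs # ?q)"
      using ij q len dist j by (auto simp: is_cycle_def N_def successively_Cons insert_commute)
    then show ?thesis using girth[of "hd xs # ?q"] len ij by simp
  qed
  obtain i j where ij: "i \<in> N" "j \<in> N" "i + (card N - 1) * (g - 2) \<le> j"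
    using gaps_imp_spread[of N "card N - 1" "g - 2"] gap cardN \<open>finite N\<close> by auto
  define p where "p = Max N"
  have "N \<noteq> {}" using ij by auto
  then have p: "p \<in> N" "\<And>i. i \<in> N \<Longrightarrow> i \<le> p" using \<open>finite N\<close> by (auto simp: p_def)
  have "k * (g - 2) \<le> (card N - 1) * (g - 2)" using cardN by (intro mult_right_mono) auto
  \<comment> \<open>The summand 1 comes from the fact that position 0 is not in
    \<open>N\<close>.\<close>
  then have p_ge: "k * (g - 2) + 1 \<le> p" using ij N_pos[of i] p(2)[of j] by linarith
  \<comment> \<open>Here \<open>k \<ge> 2\<close> enters: at least three neighbours leave one that
    is joined to the first vertex by no edge of the cycle.\<close>
  have "\<not> N \<subseteq> {1, p}"
  proof
    assume "N \<subseteq> {1, p}"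
    then have "card N \<le> card {1, p}" by (intro card_mono) auto
    also have "\<dots> \<le> 2" by (simp add: card_insert_if)
    finally show False using k cardN by simp
  qed
  then obtain r where r: "r \<in> N" "r \<noteq> 1" "r \<noteq> p" by auto
  have r': "2 \<le> r" "r < p" using r N_pos[of r] p(2)[of r] by auto
  have plen: "p < length xs" and pE: "{xs ! p, xs ! 0} \<in> E"
    using p(1) nth0 by (auto simp: N_def insert_commute)
  \<comment> \<open>The cycle consists of positions 0 to \<open>p\<close> of the path, closed by the
    edge between its positions \<open>p\<close> and 0.\<close>
  define n where "n = int p + 1"
  define f where "f x = xs ! nat (x mod n)" for x
  have n: "n > 0" by (simp add: n_def)
  have bound: "nat (x mod n) < length xs" for x
    using plen pos_mod_bound[OF n, of x] pos_mod_sign[OF n, of x] by (simp add: n_def)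
  have "chorded_cycle E f n (int r)"
  proof
    show "f x = f y \<longleftrightarrow> x mod n = y mod n" for x y
      using nth_eq_iff_index_eq[OF dist bound bound, of x y] eq_nat_nat_iff[of "x mod n" "y mod n"] n
      by (simp add: f_def)
    show "{f x, f (x + 1)} \<in> E" for x
    proof (cases "x mod n = n - 1")
      case True
      then have "(x + 1) mod n = 0" by (metis diff_add_cancel mod_add_left_eq mod_self)
      then show ?thesis using True pE by (simp add: f_def n_def)
    next
      case False
      have b: "0 \<le> x mod n" "x mod n < n" using n by auto
      then have "(x mod n + 1) mod n = x mod n + 1" using False by (intro mod_pos_pos_trivial) auto
      then have "(x + 1) mod n = x mod n + 1" by (simp add: mod_add_left_eq)
      then have "nat ((x + 1) mod n) = Suc (nat (x mod n))" using b by simp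
      then show ?thesis using edge[of "nat (x mod n)"] bound[of "x + 1"] by (simp add: f_def)
    qed
    show "{f 0, f (int r)} \<in> E" using r r' nth0 by (simp add: f_def n_def N_def)
  qed (use r' in \<open>auto simp: n_def\<close>)
  moreover have "range f \<subseteq> U" using xs bound by (auto simp: f_def)
  moreover have "int (k * (g - 2) + 2) \<le> n" unfolding n_def using p_ge by linarith
  ultimately show ?thesis by blast
qed

section \<open>Breadth-first search\<close>

definition adj :: "'a set set \<Rightarrow> ('a \<times> 'a) set" where
  "adj E = {(x, y). {x, y} \<in> E}"

text \<open>The distance from \<open>s\<close>, as a natural number. It is meaningful only for
  \<open>v\<close> reachable from \<open>s\<close>, hence the reachability hypotheses below.\<close>

definition depth :: "'a set set \<Rightarrow> 'a \<Rightarrow> 'a \<Rightarrow> nat" where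
  "depth E s v = (LEAST n. (s, v) \<in> adj E ^^ n)"

lemma adj_iff [simp]: "(x, y) \<in> adj E \<longleftrightarrow> {x, y} \<in> E"
  by (simp add: adj_def)

lemma relpow_depth:
  assumes "(s, v) \<in> (adj E)\<^sup>*"
  shows "(s, v) \<in> adj E ^^ depth E s v"
  using assms unfolding depth_def by (auto simp: rtrancl_power intro: LeastI)

lemma depth_le:
  assumes "(s, v) \<in> adj E ^^ n"
  shows "depth E s v \<le> n"
  unfolding depth_def by (rule Least_le) fact

lemma depth_root [simp]: "depth E s s = 0"
  using depth_le[where s = s and v = s and n = 0 and E = E] by simp

lemma depth_eq_0_iff:
  assumes "(s, v) \<in> (adj E)\<^sup>*"
  shows "depth E s v = 0 \<longleftrightarrow> v = s"
  using relpow_depth[OF assms] by auto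

lemma depth_step:
  assumes "(s, u) \<in> (adj E)\<^sup>*" "{u, v} \<in> E"
  shows "depth E s v \<le> Suc (depth E s u)"
  using relpow_depth[OF assms(1)] assms(2) by (intro depth_le) auto

lemma ex_parent:
  assumes "(s, v) \<in> (adj E)\<^sup>*" "0 < depth E s v"
  shows "\<exists>u. (s, u) \<in> (adj E)\<^sup>* \<and> {v, u} \<in> E \<and> Suc (depth E s u) = depth E s v"
proof -
  obtain m where m: "depth E s v = Suc m" using assms by (auto simp: gr0_conv_Suc)
  then obtain u where u: "(s, u) \<in> adj E ^^ m" "{u, v} \<in> E"
    using relpow_depth[OF assms(1)] by auto
  have "(s, u) \<in> (adj E)\<^sup>*" using u by (rule_tac relpow_imp_rtrancl)
  moreover have "depth E s u = m"
    using depth_le[OF u(1)] depth_step[OF \<open>(s, u) \<in> (adj E)\<^sup>*\<close> u(2)] m by simp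
  ultimately show ?thesis using u m by (auto simp: insert_commute)
qed

text \<open>Every edge changes sides, so sides record the parity of the number of steps.
  \<open>A\<close> is chosen before \<open>s\<close>, \<open>v\<close> and \<open>n\<close> so that
  walks from different vertices can be compared.\<close>

lemma bipartite_relpow:
  assumes "bipartite_graph V E"
  shows "\<exists>A. \<forall>s v n. (s, v) \<in> adj E ^^ n \<longrightarrow> (v \<in> A \<longleftrightarrow> (s \<in> A \<longleftrightarrow> even n))"
proof -
  obtain A B where AB: "A \<inter> B = {}" "\<forall>e\<in>E. \<exists>a\<in>A. \<exists>b\<in>B. e = {a, b}"
    using assms unfolding bipartite_graph_def by blast
  have step: "y \<in> A \<longleftrightarrow> x \<notin> A" if "{x, y} \<in> E" for x y
    using AB that by (fastforce simp: doubleton_eq_iff)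
  have "v \<in> A \<longleftrightarrow> (s \<in> A \<longleftrightarrow> even n)" if "(s, v) \<in> adj E ^^ n" for s v n
    using that by (induction n arbitrary: v) (auto simp: step)
  then show ?thesis by blast
qed

text \<open>Excludes edges inside a level; with \<open>depth_step\<close>, every reachable edge
  joins consecutive levels.\<close>

lemma even_depth_adjacent:
  assumes "bipartite_graph V E" "(s, u) \<in> (adj E)\<^sup>*" "{u, v} \<in> E"
  shows "even (depth E s v) \<longleftrightarrow> odd (depth E s u)"
proof -
  obtain A where A: "\<And>s v n. (s, v) \<in> adj E ^^ n \<Longrightarrow> (v \<in> A \<longleftrightarrow> (s \<in> A \<longleftrightarrow> even n))"
    using bipartite_relpow[OF assms(1)] by blast
  have "(s, v) \<in> (adj E)\<^sup>*" using assms by (meson adj_iff rtrancl.rtrancl_into_rtrancl)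
  moreover have "(u, v) \<in> adj E ^^ 1" using assms by simp
  ultimately show ?thesis using relpow_depth A assms(2) by (metis odd_one)
qed

text \<open>The witness \<open>j\<close> is the distance from \<open>S\<close> to its lowest common ancestor in a breadth-first
  search tree, and \<open>A\<close> consists of the members of \<open>S\<close> below one child of that ancestor.\<close>

lemma bfs_branching:
  assumes S: "\<forall>v\<in>S. (s, v) \<in> (adj E)\<^sup>* \<and> depth E s v = i"
    and two: "x \<in> S" "y \<in> S" "x \<noteq> y"
  shows "\<exists>j A. 0 < j \<and> j \<le> i \<and> A \<subset> S \<and> A \<noteq> {} \<and>
    (\<forall>a\<in>A. \<forall>b\<in>S - A. \<exists>q. simple_path E (a # q @ [b]) \<and> length q + 1 = 2 * j \<and>
      (\<forall>v\<in>set q. depth E s v < i))"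
proof -
  \<comment> \<open>Choosing one parent for each vertex fixes a search tree, in which
    \<open>anc m\<close> climbs \<open>m\<close> levels.\<close>
  define par where "par v = (SOME u. (s, u) \<in> (adj E)\<^sup>* \<and> {v, u} \<in> E \<and> Suc (depth E s u) = depth E s v)" for v
  have par: "(s, par v) \<in> (adj E)\<^sup>* \<and> {v, par v} \<in> E \<and> Suc (depth E s (par v)) = depth E s v"
    if "(s, v) \<in> (adj E)\<^sup>*" "0 < depth E s v" for v
    unfolding par_def by (rule someI_ex) (rule ex_parent[OF that])
  define anc where "anc m v = (par ^^ m) v" for m v
  have anc_Suc: "anc (Suc m) v = par (anc m v)" and anc_0 [simp]: "anc 0 v = v" for m v
    by (simp_all add: anc_def)
  have anc: "(s, anc m v) \<in> (adj E)\<^sup>* \<and> depth E s (anc m v) = i - m" if "v \<in> S" "m \<le> i" for v m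
    using that(2)
  proof (induction m)
    case (Suc m)
    then show ?case using par[of "anc m v"] by (auto simp: anc_Suc)
  qed (use S that in auto)
  have anc_edge: "{anc m v, anc (Suc m) v} \<in> E" if "v \<in> S" "m < i" for v m
    using par[of "anc m v"] anc[of v m] that by (auto simp: anc_Suc)
  have anc_mono: "anc m' a = anc m' b" if "anc m a = anc m b" "m \<le> m'" for m m' a b
    using that(2,1) by (induction rule: dec_induct) (auto simp: anc_Suc)
  define P where "P j \<longleftrightarrow> (\<exists>z. \<forall>v\<in>S. anc j v = z)" for j
  have "anc i v = s" if "v \<in> S" for v
    using anc[OF that, of i] depth_eq_0_iff[of s "anc i v"] by auto
  then have "P i" by (auto simp: P_def)
  define j where "j = (LEAST j. P j)"
  have Pj: "P j" and "j \<le> i" using \<open>P i\<close> by (auto simp: j_def intro: LeastI Least_le)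
  have "\<not> P 0" unfolding P_def using two by (metis anc_0)
  then have "j \<noteq> 0" using Pj by metis
  \<comment> \<open>By minimality of \<open>j\<close>, the ancestors \<open>m\<close> levels up are
    not all equal; they are the children of the common ancestor that split \<open>S\<close>.\<close>
  then obtain m where m: "j = Suc m" by (meson not0_implies_Suc)
  have "\<not> P m" using not_less_Least[of m P] m by (simp add: j_def)
  define A where "A = {v \<in> S. anc m v = anc m x}"
  have "A \<noteq> S" using \<open>\<not> P m\<close> by (auto simp: A_def P_def)
  then have "A \<subset> S" "A \<noteq> {}" using two by (auto simp: A_def)
  moreover have "\<exists>q. simple_path E (a # q @ [b]) \<and> length q + 1 = 2 * j \<and>
      (\<forall>v\<in>set q. depth E s v < i)" if a: "a \<in> A" and b: "b \<in> S - A" for a b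
  proof -
    have aS: "a \<in> S" and bS: "b \<in> S" and ab: "anc m a \<noteq> anc m b" using a b by (auto simp: A_def)
    \<comment> \<open>Only \<open>q1\<close> contains the common ancestor, so there are
      \<open>j + (j - 1)\<close> inner vertices.\<close>
    define q1 q2 where "q1 = map (\<lambda>l. anc l a) [1..<Suc j]" and "q2 = map (\<lambda>l. anc l b) [1..<j]"
    have inj: "inj_on (\<lambda>l. anc l v) {0..<Suc j}" if "v \<in> S" for v
    proof (rule inj_onI)
      fix l l' assume "l \<in> {0..<Suc j}" "l' \<in> {0..<Suc j}" "anc l v = anc l' v"
      then have "i - l = i - l'" "l \<le> i" "l' \<le> i"
        using anc[OF that, of l] anc[OF that, of l'] \<open>j \<le> i\<close> by auto
      then show "l = l'" by simp
    qed
    have path1: "simple_path E (map (\<lambda>l. anc l a) [0..<Suc j])"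
      using inj[OF aS] anc_edge[OF aS] \<open>j \<le> i\<close>
      by (auto simp: simple_path_def distinct_map successively_conv_nth simp del: upt_Suc)
    have path2: "simple_path E (map (\<lambda>l. anc l b) [0..<j])"
      using inj_on_subset[OF inj[OF bS]] anc_edge[OF bS] \<open>j \<le> i\<close> \<open>j \<noteq> 0\<close>
      by (auto simp: simple_path_def distinct_map successively_conv_nth)
    have "anc j a = anc (Suc m) b" using Pj aS bS m by (auto simp: P_def)
    then have link: "{anc j a, anc m b} \<in> E"
      using anc_edge[OF bS, of m] m \<open>j \<le> i\<close> by (simp add: insert_commute)
    \<comment> \<open>Equal vertices have equal depth, so \<open>l = l'\<close>; branches meeting at
      level \<open>l \<le> m\<close> would still coincide at \<open>m\<close>.\<close>
    have "anc l a \<noteq> anc l' b" if "l \<le> j" "l' < j" for l l'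
    proof
      assume eq: "anc l a = anc l' b"
      then have "i - l = i - l'" using anc[OF aS, of l] anc[OF bS, of l'] that \<open>j \<le> i\<close> by auto
      then have "l = l'" using that \<open>j \<le> i\<close> by auto
      then show False using anc_mono[of l a b m] eq ab that m by auto
    qed
    then have disj: "set (map (\<lambda>l. anc l a) [0..<Suc j]) \<inter> set (rev (map (\<lambda>l. anc l b) [0..<j])) = {}"
      by (auto simp del: upt_Suc)
    have last: "last (map (\<lambda>l. anc l a) [0..<Suc j]) = anc j a"
      by (simp add: last_map)
    have hd: "hd (rev (map (\<lambda>l. anc l b) [0..<j])) = anc m b"
      using m by simp
    have "simple_path E (map (\<lambda>l. anc l a) [0..<Suc j] @ rev (map (\<lambda>l. anc l b) [0..<j]))"
      by (intro simple_path_append path1 disj) (use path2 last hd link in \<open>simp_all only: simple_path_rev\<close>)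
    moreover have "map (\<lambda>l. anc l a) [0..<Suc j] = a # q1"
      by (simp add: q1_def upt_conv_Cons del: upt_Suc)
    moreover have "map (\<lambda>l. anc l b) [0..<j] = b # q2"
      using \<open>j \<noteq> 0\<close> by (simp add: q2_def upt_conv_Cons)
    ultimately have "simple_path E (a # (q1 @ rev q2) @ [b])" by (simp del: upt_Suc)
    moreover have "length (q1 @ rev q2) + 1 = 2 * j"
      using \<open>j \<noteq> 0\<close> by (simp add: q1_def q2_def del: upt_Suc)
    moreover have "\<forall>v\<in>set (q1 @ rev q2). depth E s v < i"
      using anc[OF aS] anc[OF bS] \<open>j \<le> i\<close> by (auto simp: q1_def q2_def simp del: upt_Suc)
    ultimately show ?thesis by blast
  qed
  ultimately show ?thesis using \<open>j \<noteq> 0\<close> \<open>j \<le> i\<close> by blast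
qed

section \<open>Dense subgraphs\<close>

definition induced_edges :: "'a set set \<Rightarrow> 'a set \<Rightarrow> 'a set set" where
  "induced_edges E U = {e \<in> E. e \<subseteq> U}"

lemma finite_induced_edges: "finite U \<Longrightarrow> finite (induced_edges E U)"
  by (rule finite_subset[of _ "Pow U"]) (auto simp: induced_edges_def)

text \<open>Deleting a vertex of degree at most \<open>k\<close> loses at most \<open>k\<close>
  edges and preserves the strict inequality, which fails for the empty set.\<close>

lemma ex_min_degree_subgraph:
  assumes "finite U" and E: "\<And>e. e \<in> E \<Longrightarrow> \<exists>u v. e = {u, v}"
    and "k * card U < card (induced_edges E U)"
  shows "\<exists>W\<subseteq>U. W \<noteq> {} \<and> (\<forall>v\<in>W. k < card {u \<in> W. {v, u} \<in> E})"
  using assms(1,3)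
proof (induction U rule: finite_psubset_induct)
  case (psubset U)
  show ?case
  proof (cases "\<forall>v\<in>U. k < card {u \<in> U. {v, u} \<in> E}")
    case True
    have "{} \<notin> E" using E by fastforce
    then have "induced_edges E {} = {}" by (auto simp: induced_edges_def)
    then have "U \<noteq> {}" using psubset.prems by auto
    then show ?thesis using True by blast
  next
    case False
    then obtain v where v: "v \<in> U" "card {u \<in> U. {v, u} \<in> E} \<le> k" by auto
    let ?N = "{u \<in> U. {v, u} \<in> E}"
    have "induced_edges E U \<subseteq> induced_edges E (U - {v}) \<union> (\<lambda>u. {v, u}) ` ?N"
    proof
      fix e assume e: "e \<in> induced_edges E U"
      then obtain x y where xy: "e = {x, y}" using E[of e] by (auto simp: induced_edges_def)
      show "e \<in> induced_edges E (U - {v}) \<union> (\<lambda>u. {v, u}) ` ?N"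
      proof (cases "v \<in> e")
        case True
        then obtain u where "e = {v, u}" using xy by (auto simp: insert_commute)
        then show ?thesis using e by (auto simp: induced_edges_def)
      next
        case False
        then show ?thesis using e by (auto simp: induced_edges_def)
      qed
    qed
    then have "card (induced_edges E U) \<le> card (induced_edges E (U - {v}) \<union> (\<lambda>u. {v, u}) ` ?N)"
      using \<open>finite U\<close> by (intro card_mono) (auto simp: finite_induced_edges)
    also have "\<dots> \<le> card (induced_edges E (U - {v})) + card ((\<lambda>u. {v, u}) ` ?N)"
      by (rule card_Un_le)
    also have "card ((\<lambda>u. {v, u}) ` ?N) \<le> k"
      using card_image_le[of ?N "\<lambda>u. {v, u}"] v \<open>finite U\<close> by simp
    finally have "card (induced_edges E U) \<le> card (induced_edges E (U - {v})) + k" by simp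
    moreover have "card U = Suc (card (U - {v}))"
      using card_Suc_Diff1[OF \<open>finite U\<close> v(1)] by simp
    ultimately have "k * card (U - {v}) < card (induced_edges E (U - {v}))"
      using psubset.prems by simp
    then show ?thesis using psubset.IH[of "U - {v}"] v by blast
  qed
qed

text \<open>Split off the component of a vertex: no edge joins it to the rest of \<open>W\<close>,
  so one of the two parts is as dense as required. The conclusion holds for every \<open>s\<close>
  in \<open>C\<close>, which leaves the root of the search free.\<close>

lemma ex_dense_component:
  assumes "finite W" "W \<noteq> {}" and E: "\<And>e. e \<in> E \<Longrightarrow> \<exists>u v. e = {u, v}"
    and "\<And>x y. x \<in> W \<Longrightarrow> {x, y} \<in> E \<Longrightarrow> y \<in> W"
    and "m * card W \<le> card (induced_edges E W)"
  shows "\<exists>C\<subseteq>W. C \<noteq> {} \<and> m * card C \<le> card (induced_edges E C) \<and> (\<forall>s\<in>C. C = (adj E)\<^sup>* `` {s})"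
  using assms(1,2,4,5)
proof (induction W rule: finite_psubset_induct)
  case (psubset W)
  show ?case
  proof (cases "\<forall>s\<in>W. W = (adj E)\<^sup>* `` {s}")
    case True
    then show ?thesis using psubset.prems by blast
  next
    case False
    then obtain s where s: "s \<in> W" "W \<noteq> (adj E)\<^sup>* `` {s}" by auto
    define C where "C = (adj E)\<^sup>* `` {s}"
    have "v \<in> W" if "(s, v) \<in> (adj E)\<^sup>*" for v
      using that by induction (use s psubset.prems(2) in auto)
    then have "C \<subset> W" using s by (auto simp: C_def)
    have "s \<in> C" by (simp add: C_def)
    have C_closed: "y \<in> C" if "x \<in> C" "{x, y} \<in> E" for x y
      using that unfolding C_def by (auto intro: rtrancl_into_rtrancl)
    have D_closed: "y \<in> W - C" if "x \<in> W - C" "{x, y} \<in> E" for x y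
      using that C_closed[of y x] psubset.prems(2)[of x y] by (auto simp: insert_commute)
    have fin: "finite C" "finite (W - C)" using \<open>finite W\<close> \<open>C \<subset> W\<close> by (auto intro: finite_subset)
    have "induced_edges E W \<subseteq> induced_edges E C \<union> induced_edges E (W - C)"
    proof
      fix e assume e: "e \<in> induced_edges E W"
      then obtain x y where "e = {x, y}" using E[of e] by (auto simp: induced_edges_def)
      then show "e \<in> induced_edges E C \<union> induced_edges E (W - C)"
        using e C_closed[of x y] D_closed[of x y] by (auto simp: induced_edges_def)
    qed
    then have "card (induced_edges E W) \<le> card (induced_edges E C \<union> induced_edges E (W - C))"
      using fin by (intro card_mono) (auto simp: finite_induced_edges)
    also have "\<dots> \<le> card (induced_edges E C) + card (induced_edges E (W - C))"
      by (rule card_Un_le)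
    finally have le: "card (induced_edges E W) \<le> \<dots>" .
    have "card W = card C + card (W - C)"
      using \<open>C \<subset> W\<close> \<open>finite W\<close> by (metis card_Diff_subset card_mono fin(1) le_add_diff_inverse psubset_imp_subset)
    then have "m * card W = m * card C + m * card (W - C)" by (simp add: distrib_left)
    then consider "m * card C \<le> card (induced_edges E C)"
      | "m * card (W - C) \<le> card (induced_edges E (W - C))"
      using le psubset.prems(3) by linarith
    then show ?thesis
    proof cases
      case 1
      have "C \<noteq> {}" using \<open>s \<in> C\<close> by auto
      have "\<exists>D\<subseteq>C. D \<noteq> {} \<and> m * card D \<le> card (induced_edges E D) \<and>
          (\<forall>s\<in>D. D = (adj E)\<^sup>* `` {s})"
        by (rule psubset.IH[of C]) (fact | erule (1) C_closed)+
      then show ?thesis using \<open>C \<subset> W\<close> by (meson order_trans psubset_imp_subset)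
    next
      case 2
      have "W - C \<subset> W" "W - C \<noteq> {}" using \<open>C \<subset> W\<close> \<open>s \<in> C\<close> by auto
      have "\<exists>D\<subseteq>W - C. D \<noteq> {} \<and> m * card D \<le> card (induced_edges E D) \<and>
          (\<forall>s\<in>D. D = (adj E)\<^sup>* `` {s})"
        by (rule psubset.IH[of "W - C"]) (fact | erule (1) D_closed)+
      then show ?thesis by (meson Diff_subset order_trans)
    qed
  qed
qed

text \<open>Every edge lies in some pair of consecutive levels, while each vertex lies in at most
  two pairs. If all pairs were sparse, \<open>W\<close> would span fewer than
  \<open>2 * k * card W\<close> edges.\<close>

lemma ex_dense_levels:
  fixes d :: "'a \<Rightarrow> nat"
  assumes "finite W" "s \<in> W" "d s = 0" "0 < k"
    and edges: "\<And>e. e \<in> induced_edges E W \<Longrightarrow> \<exists>u v. e = {u, v} \<and> d v = Suc (d u)"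
    and dense: "2 * k * card W \<le> card (induced_edges E W)"
  shows "\<exists>i. k * card {v \<in> W. d v = i \<or> d v = Suc i}
           < card (induced_edges E {v \<in> W. d v = i \<or> d v = Suc i})"
proof (rule ccontr)
  define L where "L i = {v \<in> W. d v = i}" for i
  define U where "U i = {v \<in> W. d v = i \<or> d v = Suc i}" for i
  assume "\<not> ?thesis"
  then have sparse: "card (induced_edges E (U i)) \<le> k * card (U i)" for i
    by (auto simp: U_def not_less)
  have fin: "finite (L i)" "finite (U i)" for i using \<open>finite W\<close> by (auto simp: L_def U_def)
  define N where "N = Suc (Max (d ` W))"
  have dN: "d v < N" if "v \<in> W" for v
    using that \<open>finite W\<close> by (auto simp: N_def less_Suc_eq_le)
  have sumL: "(\<Sum>i<M. card (L i)) = card W" if "N \<le> M" for M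
  proof -
    have "(\<Sum>i<M. card (L i)) = card (\<Union>i<M. L i)"
      using fin by (subst card_UN_disjoint) (auto simp: L_def)
    also have "(\<Union>i<M. L i) = W" using dN that by (fastforce simp: L_def)
    finally show ?thesis .
  qed
  have U_card: "card (U i) \<le> card (L i) + card (L (Suc i))" for i
  proof -
    have "U i = L i \<union> L (Suc i)" by (auto simp: U_def L_def)
    then show ?thesis by (simp add: card_Un_le)
  qed
  have "card (L 0) > 0" using assms fin by (auto simp: card_gt_0_iff L_def)
  have "induced_edges E W \<subseteq> (\<Union>i<N. induced_edges E (U i))"
  proof
    fix e assume e: "e \<in> induced_edges E W"
    then obtain u v where uv: "e = {u, v}" "d v = Suc (d u)" using edges by blast
    then have "e \<in> induced_edges E (U (d u))" "d u < N"
      using e dN by (auto simp: induced_edges_def U_def)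
    then show "e \<in> (\<Union>i<N. induced_edges E (U i))" by blast
  qed
  then have "card (induced_edges E W) \<le> card (\<Union>i<N. induced_edges E (U i))"
    using fin by (intro card_mono) (auto simp: finite_induced_edges)
  also have "\<dots> \<le> (\<Sum>i<N. card (induced_edges E (U i)))"
    by (rule card_UN_le) simp
  also have "\<dots> \<le> (\<Sum>i<N. k * (card (L i) + card (L (Suc i))))"
    using sparse U_card by (intro sum_mono) (meson le_trans mult_le_mono2)
  also have "\<dots> = k * ((\<Sum>i<N. card (L i)) + (\<Sum>i<N. card (L (Suc i))))"
    by (simp only: sum.distrib flip: sum_distrib_left)
  \<comment> \<open>The inequality is strict because the shifted sum omits level 0, which contains
    \<open>s\<close>.\<close>
  also have "\<dots> < k * ((\<Sum>i<N. card (L i)) + (\<Sum>i<Suc N. card (L i)))"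
    using \<open>0 < k\<close> \<open>card (L 0) > 0\<close> by (subst sum.lessThan_Suc_shift) simp
  also have "\<dots> = 2 * k * card W"
    using sumL[of N] sumL[of "Suc N"] by (simp del: sum.lessThan_Suc)
  finally show False using dense by simp
qed

section \<open>Consecutive even cycle lengths\<close>

text \<open>\<open>q\<close> lists only the inner vertices of the second path, so the two lists are
  disjoint although the paths share their ends.\<close>

lemma simple_paths_imp_cycle:
  assumes p: "simple_path E p" and q: "simple_path E (hd p # q @ [last p])"
    and "set p \<inter> set q = {}" "q \<noteq> []" "3 \<le> length p"
  shows "is_cycle E (p @ rev q)"
proof -
  have ends: "{hd p, hd q} \<in> E" "{last p, last q} \<in> E" and "simple_path E q"
    using q \<open>q \<noteq> []\<close>
    by (simp_all add: simple_path_def successively_Cons successively_append_iff insert_commute)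
  then have "simple_path E (p @ rev q)"
    using p assms(3) \<open>q \<noteq> []\<close> by (intro simple_path_append) (simp_all add: simple_path_rev hd_rev)
  moreover have "last (p @ rev q) = hd q" "hd (p @ rev q) = hd p"
    using p \<open>q \<noteq> []\<close> by (simp_all add: simple_path_def last_rev)
  ultimately show ?thesis
    using ends(1) \<open>3 \<le> length p\<close> by (simp add: is_cycle_def simple_path_def insert_commute)
qed

text \<open>Each edge flips the parity of the depth, and \<open>length p\<close> is one more than
  the number of edges.\<close>

lemma even_depth_path:
  assumes "bipartite_graph V E" "(s, hd p) \<in> (adj E)\<^sup>*" "p \<noteq> []"
    and "successively (\<lambda>x y. {x, y} \<in> E) p"
  shows "even (depth E s (hd p) + depth E s (last p)) \<longleftrightarrow> odd (length p)"
  using assms(2-4)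
proof (induction p)
  case (Cons x p)
  show ?case
  proof (cases "p = []")
    case False
    then have "{x, hd p} \<in> E" using Cons.prems by (auto simp: successively_Cons)
    moreover have "(s, hd p) \<in> (adj E)\<^sup>*"
      using Cons.prems \<open>{x, hd p} \<in> E\<close> by (auto intro: rtrancl_into_rtrancl)
    ultimately show ?thesis
      using Cons even_depth_adjacent[OF assms(1), of s x "hd p"] False by (auto simp: successively_Cons)
  qed simp
qed simp

text \<open>A path of even length \<open>2 * i + 2\<close> leaving \<open>A\<close> inside the two levels is closed up through the
  breadth-first search tree.\<close>

lemma ex_consecutive_even_cycles:
  assumes "bipartite_graph V E"
    and cyc: "chorded_cycle E f n r"
    and f: "\<And>x. (s, f x) \<in> (adj E)\<^sup>*" "\<And>x. depth E s (f x) = h \<or> depth E s (f x) = Suc h"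
  shows "(\<exists>x. depth E s (f x) = Suc h) \<and>
    (\<exists>j. j \<le> h \<and> (\<forall>i. int (2 * i + 2) < n \<longrightarrow> has_cycle_of_length E (2 * j + 2 + 2 * i)))"
proof -
  interpret chorded_cycle E f n r by (rule cyc)
  have alt: "depth E s (f (x + 1)) = h \<longleftrightarrow> depth E s (f x) = Suc h" for x
    using even_depth_adjacent[OF assms(1) f(1) edge, of x] f(2)[of x] f(2)[of "x + 1"] by auto
  define S where "S = {f x |x. depth E s (f x) = h}"
  obtain x0 where x0: "depth E s (f x0) = h" using f(2)[of 0] alt[of 0] by auto
  have per: "depth E s (f (x + 2)) = h \<longleftrightarrow> depth E s (f x) = h" for x
    using alt[of x] alt[of "x + 1"] f(2)[of x] f(2)[of "x + 1"] f(2)[of "x + 2"]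
    by (auto simp: add.assoc)
  have x0S: "f x0 \<in> S" "f (x0 + 2) \<in> S" using x0 per by (auto simp: S_def)
  have x0_neq: "f x0 \<noteq> f (x0 + 2)" using r by (intro f_neq) auto
  have S: "\<forall>v\<in>S. (s, v) \<in> (adj E)\<^sup>* \<and> depth E s v = h"
    using f by (auto simp: S_def)
  from bfs_branching[OF S x0S x0_neq]
  obtain j A where j: "0 < j" "j \<le> h" and A: "A \<subset> S" "A \<noteq> {}"
    and tree: "\<forall>a\<in>A. \<forall>b\<in>S - A. \<exists>q. simple_path E (a # q @ [b]) \<and>
      length q + 1 = 2 * j \<and> (\<forall>v\<in>set q. depth E s v < h)"
    by (elim exE conjE)
  \<comment> \<open>The cycle alternates between the two levels, so level \<open>h\<close> occupies
    the positions of one parity. If \<open>A\<close> were invariant under steps of 2, it would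
    contain all of \<open>S\<close>.\<close>
  have "\<exists>z. f (z + 2) \<in> A \<longleftrightarrow> f z \<notin> A"
  proof (rule ccontr)
    assume "\<not> ?thesis"
    then have inv: "f (z + 2) \<in> A \<longleftrightarrow> f z \<in> A" for z by blast
    have inv': "f (z + m * 2) \<in> A \<longleftrightarrow> f z \<in> A" for z m
      by (rule periodic_mult[of "\<lambda>z. f z \<in> A" 2, OF inv])
    have per': "depth E s (f (z + m * 2)) = h \<longleftrightarrow> depth E s (f z) = h" for z m
      by (rule periodic_mult[of "\<lambda>z. depth E s (f z) = h" 2, OF per])
    obtain y where y: "f y \<in> A" "depth E s (f y) = h" using A by (auto simp: S_def)
    have "f x \<in> A" if x: "depth E s (f x) = h" for x
    proof (cases "even (x - y)")
      case True
      then obtain m where "x - y = 2 * m" by (elim evenE)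
      then have "x = y + m * 2" by simp
      then show ?thesis using inv' y by simp
    next
      case False
      then obtain m where "x - y = 2 * m + 1" by (elim oddE)
      then have "x = (y + 1) + m * 2" by simp
      then show ?thesis using per'[of "y + 1" m] alt[of y] x y by simp
    qed
    then show False using A by (auto simp: S_def)
  qed
  then obtain z where z: "f (z + 2) \<in> A \<longleftrightarrow> f z \<notin> A" by blast
  have "has_cycle_of_length E (2 * j + 2 + 2 * i)" if i: "int (2 * i + 2) < n" for i
  proof -
    obtain p where p: "simple_path E p" "set p \<subseteq> range f" "length p = 2 * i + 2 + 1"
      "hd p \<in> A" "last p \<notin> A"
      using ex_path_leaving[of "2 * i + 2" z A] i z by auto
    have ne: "p \<noteq> []" using p(3) by auto
    have "hd p \<in> S" using p A by auto
    then have dh: "depth E s (hd p) = h" by (auto simp: S_def)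
    have "last p \<in> range f" using ne p(2) by (meson last_in_set subsetD)
    then obtain x where x: "last p = f x" by auto
    have "even (depth E s (hd p) + depth E s (last p))"
      using even_depth_path[OF assms(1), of s p] \<open>hd p \<in> S\<close> f(1) p ne
      by (auto simp: simple_path_def S_def)
    \<comment> \<open>This is where even path lengths matter: the path returns to level
      \<open>h\<close> and, being outside \<open>A\<close>, ends in \<open>S - A\<close>.\<close>
    then have "depth E s (last p) = h" using dh f(2)[of x] x by auto
    then have "last p \<in> S - A" using p x by (auto simp: S_def)
    then obtain q where q: "simple_path E (hd p # q @ [last p])" "length q + 1 = 2 * j"
      "\<forall>v\<in>set q. depth E s v < h"
      using tree p by blast
    have "set p \<inter> set q = {}"
    proof -
      have "h \<le> depth E s v" if "v \<in> set p" for v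
        using that p(2) f(2) by (metis imageE le_SucI order_refl subsetD)
      then show ?thesis using q(3) by (meson disjoint_iff not_le)
    qed
    moreover have "q \<noteq> []" using q(2) by auto
    ultimately have "is_cycle E (p @ rev q)"
      using p q by (intro simple_paths_imp_cycle) auto
    moreover have "length (p @ rev q) = 2 * j + 2 + 2 * i" using p q by simp
    ultimately show ?thesis by (auto simp: has_cycle_of_length_def)
  qed
  \<comment> \<open>A vertex this deep supplies the extra 1 in the radius bound.\<close>
  moreover have "depth E s (f (x0 + 1)) = Suc h" using alt[of x0] f(2)[of "x0 + 1"] x0 by auto
  ultimately show ?thesis using j by blast
qed

section \<open>Depth compared with graph distance and radius\<close>

lemma walk_imp_relpow:
  assumes "is_walk V E u p v"
  shows "(u, v) \<in> adj E ^^ (length p - 1)"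
proof -
  have p: "p \<noteq> []" "hd p = u" "last p = v" "successively (\<lambda>x y. {x, y} \<in> E) p"
    using assms by (auto simp: is_walk_def)
  have "(hd p, last p) \<in> adj E ^^ (length p - 1)"
    using p(1,4)
  proof (induction p)
    case (Cons x p)
    show ?case
    proof (cases p)
      case Nil
      then show ?thesis by simp
    next
      case (Cons y p')
      then have "(y, last p) \<in> adj E ^^ (length p - 1)" "(x, y) \<in> adj E"
        using Cons.IH Cons.prems by auto
      then have "(x, last p) \<in> adj E ^^ Suc (length p - 1)" by (rule relpow_Suc_I2[rotated])
      then show ?thesis using Cons by simp
    qed
  qed simp
  then show ?thesis using p by simp
qed

text \<open>The arguments are swapped to match \<open>radius\<close>, whose centre is the second
  argument of \<open>graph_dist\<close>. Without a walk the infimum is infinite and the bound is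
  trivial.\<close>

lemma depth_le_graph_dist:
  "enat (depth E s v) \<le> graph_dist V E v s"
  unfolding graph_dist_def
proof (rule INF_greatest)
  fix p assume "p \<in> {p. is_walk V E v p s}"
  then have "is_walk V E s (rev p) v"
    by (auto simp: is_walk_def hd_rev last_rev insert_commute)
  then show "enat (depth E s v) \<le> enat (length p - 1)"
    using depth_le[OF walk_imp_relpow] by fastforce
qed

lemma Inf_enat_in:
  fixes X :: "enat set"
  assumes "X \<noteq> {}"
  shows "Inf X \<in> X"
  using assms by (auto simp: Inf_enat_def intro: LeastI)

theorem theorem1:
  fixes V :: "'a set" and E :: "'a set set" and k g :: nat
  assumes "k \<ge> 2"
    and "finite_simple_graph V E"
    and "bipartite_graph V E"
    and "average_degree V E \<ge> 4 * real k"
    and "girth E = enat g"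
  shows "\<exists>l::nat. even l
      \<and> (\<forall>i::nat. real i < (real g / 2 - 1) * real k \<longrightarrow> has_cycle_of_length E (l + 2 * i))
      \<and> (connected_graph V E \<longrightarrow> enat l \<le> 2 * radius V E)"
proof -
  have "finite V" and edgeV: "\<And>e. e \<in> E \<Longrightarrow> \<exists>u\<in>V. \<exists>v\<in>V. u \<noteq> v \<and> e = {u, v}"
    using assms(2) by (auto simp: finite_simple_graph_def)
  have pair: "\<exists>u v. e = {u, v}" if "e \<in> E" for e using edgeV[OF that] by blast
  have loopless: "{v} \<notin> E" for v
    using edgeV[of "{v}"] by (metis doubleton_eq_iff insert_absorb2)
  have inV: "x \<in> V \<and> y \<in> V" if "{x, y} \<in> E" for x y
    using edgeV[OF that] by (auto simp: doubleton_eq_iff)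
  have girth: "g \<le> length c" if "is_cycle E c" for c
  proof -
    have "girth E \<le> enat (length c)" unfolding girth_def using that by (intro INF_lower) simp
    then show ?thesis using assms(5) by simp
  qed
  \<comment> \<open>For an empty \<open>V\<close> division by zero would make the average degree
    0.\<close>
  have V: "card V > 0" using assms(1,4) by (auto simp: average_degree_def intro: ccontr)
  then have "V \<noteq> {}" by auto
  have "4 * real k * real (card V) \<le> 2 * real (card E)"
    using assms(4) V by (simp add: average_degree_def field_simps)
  then have "real (2 * k * card V) \<le> real (card E)" by simp
  then have "2 * k * card V \<le> card E" by (simp only: of_nat_le_iff)
  moreover have "induced_edges E V = E" using edgeV by (fastforce simp: induced_edges_def)
  ultimately obtain W where W: "W \<subseteq> V" "W \<noteq> {}" "2 * k * card W \<le> card (induced_edges E W)"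
    and comp: "\<And>s. s \<in> W \<Longrightarrow> W = (adj E)\<^sup>* `` {s}"
    using ex_dense_component[of V E "2 * k"] \<open>finite V\<close> \<open>V \<noteq> {}\<close> pair inV by metis
  have "finite W" using W \<open>finite V\<close> finite_subset by blast
  \<comment> \<open>In a connected graph the root is a vertex attaining the radius, and it lies in
    the component \<open>W\<close>; otherwise any vertex of \<open>W\<close> serves.\<close>
  have ecc: "\<exists>s\<in>W. connected_graph V E \<longrightarrow> (\<forall>v\<in>V. enat (depth E s v) \<le> radius V E)"
  proof (cases "connected_graph V E")
    case True
    have "radius V E \<in> (\<lambda>v. SUP u\<in>V. graph_dist V E u v) ` V"
      unfolding radius_def using \<open>V \<noteq> {}\<close> \<open>finite V\<close>
      by (intro Inf_enat_in) auto
    then obtain s where s: "s \<in> V" "radius V E = (SUP u\<in>V. graph_dist V E u s)" by auto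
    have "enat (depth E s v) \<le> radius V E" if "v \<in> V" for v
    proof -
      have "graph_dist V E v s \<le> radius V E" unfolding s(2) using that by (rule SUP_upper)
      then show ?thesis using depth_le_graph_dist[of E s v V] by (rule order_trans[rotated])
    qed
    moreover have "s \<in> W"
    proof -
      obtain w where w: "w \<in> W" using W by auto
      then obtain p where "is_walk V E w p s"
        using True s(1) W(1) unfolding connected_graph_def by blast
      then have "(w, s) \<in> (adj E)\<^sup>*" by (metis walk_imp_relpow relpow_imp_rtrancl)
      then show ?thesis using comp[OF w] by blast
    qed
    ultimately show ?thesis by blast
  qed (use W in auto)
  then obtain s where s: "s \<in> W"
    and radius: "connected_graph V E \<Longrightarrow> v \<in> V \<Longrightarrow> enat (depth E s v) \<le> radius V E" for v
    by blast
  have reach: "v \<in> W \<longleftrightarrow> (s, v) \<in> (adj E)\<^sup>*" for v using comp[OF s] by auto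
  have levels: "\<exists>u v. e = {u, v} \<and> depth E s v = Suc (depth E s u)" if "e \<in> induced_edges E W" for e
  proof -
    have "e \<in> E" "e \<subseteq> W" using that by (auto simp: induced_edges_def)
    then obtain x y where xy: "e = {x, y}" "{x, y} \<in> E" "x \<in> W" "y \<in> W"
      using pair by blast
    then have "(s, x) \<in> (adj E)\<^sup>*" "(s, y) \<in> (adj E)\<^sup>*" "{y, x} \<in> E"
      by (auto simp: reach insert_commute)
    then have "depth E s y \<le> Suc (depth E s x)" "depth E s x \<le> Suc (depth E s y)"
      "depth E s x \<noteq> depth E s y"
      using depth_step xy even_depth_adjacent[OF assms(3), of s x y] by metis+
    then have "depth E s y = Suc (depth E s x) \<or> depth E s x = Suc (depth E s y)" by auto
    then show ?thesis using xy by (auto simp: insert_commute)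
  qed
  obtain h where h: "k * card {v \<in> W. depth E s v = h \<or> depth E s v = Suc h}
      < card (induced_edges E {v \<in> W. depth E s v = h \<or> depth E s v = Suc h})"
    using ex_dense_levels[of W s "depth E s" k E] \<open>finite W\<close> s assms(1) levels W by auto
  let ?U = "{v \<in> W. depth E s v = h \<or> depth E s v = Suc h}"
  obtain H where H: "H \<subseteq> ?U" "H \<noteq> {}" "\<And>v. v \<in> H \<Longrightarrow> k < card {u \<in> H. {v, u} \<in> E}"
    using ex_min_degree_subgraph[of ?U E k] \<open>finite W\<close> pair h by auto
  have "finite H" using H \<open>finite W\<close> by (auto intro: finite_subset)
  obtain f n r where f: "chorded_cycle E f n r" "range f \<subseteq> H" and n: "int (k * (g - 2) + 2) \<le> n"
    using min_degree_imp_chorded_cycle[of H k E g] \<open>finite H\<close> H assms(1) loopless girth by blast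
  have fU: "f x \<in> ?U" for x using f H by blast
  obtain x j where x: "depth E s (f x) = Suc h" and "j \<le> h"
    and cycles: "\<And>i. int (2 * i + 2) < n \<Longrightarrow> has_cycle_of_length E (2 * j + 2 + 2 * i)"
    using ex_consecutive_even_cycles[OF assms(3) f(1), of s h] fU by (auto simp: reach)
  show ?thesis
  proof (intro exI conjI allI impI)
    show "even (2 * j + 2)" by simp
  next
    fix i :: nat assume i: "real i < (real g / 2 - 1) * real k"
    have "0 \<le> real i" by simp
    with i have "0 < (real g / 2 - 1) * real k" by linarith
    then have "real g / 2 - 1 > 0" by (simp add: zero_less_mult_iff)
    \<comment> \<open>This makes the natural subtraction \<open>g - 2\<close> exact, so the bound on
      \<open>i\<close> becomes \<open>2 * i + 2 < k * (g - 2) + 2 \<le> n\<close>.\<close>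
    then have "g \<ge> 2" by simp
    then have "real (2 * i) < real (k * (g - 2))" using i by (simp add: of_nat_diff field_simps)
    then have "2 * i < k * (g - 2)" by (simp only: of_nat_less_iff)
    then show "has_cycle_of_length E (2 * j + 2 + 2 * i)" using n by (intro cycles) linarith
  next
    assume conn: "connected_graph V E"
    have "f x \<in> V" using fU W by auto
    \<comment> \<open>The shortest cycle has length \<open>2 * (j + 1)\<close> with
      \<open>j \<le> h\<close>, and the cycle with its chord reaches depth
      \<open>h + 1\<close>.\<close>
    then have "enat (Suc h) \<le> radius V E" using radius[OF conn] x by metis
    moreover have "enat (Suc j) \<le> enat (Suc h)" using \<open>j \<le> h\<close> by simp
    ultimately have "enat (Suc j) \<le> radius V E" by (rule order_trans[rotated])
    then have "2 * enat (Suc j) \<le> 2 * radius V E" by (rule mult_left_mono) simp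
    then show "enat (2 * j + 2) \<le> 2 * radius V E" by (simp add: numeral_eq_enat)
  qed
qed

end
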